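(* Consider the RBCD method and assume $0<\gamma\le2/\|A\|^2$. Then along any sample path there holds $$\|A(x_k^\delta-x_k)-y^\delta+y\|\le\delta$$ for all integers $k\ge0$. Furthermore, $$\mathbb E\big[\|x_k^\delta-x_k\|^2\big]\le\frac{2\gamma}{b}k\delta^2$$ for all $k\ge0$.
   Context: Let $b\ge1$, let $X_1,\dots,X_b$ and $\mathcal Y$ be real Hilbert spaces, and let $A_i:X_i\to\mathcal Y$ be bounded linear operators with adjoints $A_i^*$. Let $\mathcal X:=X_1\times\cdots\times X_b$ with the natural product inner product and define $A:\mathcal X\to\mathcal Y$, $Ax:=\sum_{i=1}^bA_ix_i$ for $x=(x_1,\dots,x_b)$. It is assumed that $y\in\mathrm{Ran}(A)$, and $y^\delta\in\mathcal Y$ is noisy data with $\|y^\delta-y\|\le\delta$, where $\delta>0$. RBCD method: let $i_0,i_1,\dots$ be independent random indices, each uniformly distributed on $\{1,\dots,b\}$. Starting from $x_0^\delta:=x_0\in\mathcal X$, with step size $\gamma>0$, for $k\ge0$ set $x^\delta_{k+1,i}=x^\delta_{k,i}$ for $i\ne i_k$ and $x^\delta_{k+1,i_k}=x^\delta_{k,i_k}-\gamma A_{i_k}^*(Ax^\delta_k-y^\delta)$. The sequence $\{x_k\}$ is produced in the same way, with the same $x_0$, $\gamma$ and the same index sequence $\{i_k\}$, but with $y^\delta$ replaced by $y$. A sample path is a realization of $\{i_0,i_1,\dots\}$; $\mathbb E$ is expectation with respect to the random indices. *)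

theory Defs
  imports "HOL-Probability.Probability"
begin

text \<open>
  The blocks are indexed by a finite type \<open>'n\<close>, so that the number of blocks is \<open>CARD('n)\<close>.
  Since distinct blocks may be different Hilbert spaces, the \<open>i\<close>-th one is represented as a
  complete linear subspace \<open>X i\<close> of an ambient inner product space \<open>'a\<close>. This is no restriction:
  any family of Hilbert spaces embeds isometrically into its Hilbert direct sum. Operators on a
  block are functions on \<open>'a\<close> of which only the values on the block matter.
\<close>

definition is_bounded_linear_on ::
  "'a::real_normed_vector set \<Rightarrow> ('a \<Rightarrow> 'b::real_normed_vector) \<Rightarrow> bool" where
  "is_bounded_linear_on S f \<longleftrightarrow>
     (\<forall>u\<in>S. \<forall>v\<in>S. f (u + v) = f u + f v) \<and>
     (\<forall>c. \<forall>u\<in>S. f (c *\<^sub>R u) = c *\<^sub>R f u) \<and>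
     (\<exists>K. \<forall>u\<in>S. norm (f u) \<le> norm u * K)"

text \<open>
  Relativised version of \<^const>\<open>onorm\<close>; in particular it is \<open>0\<close> if \<open>S\<close> is the trivial space.
\<close>

definition onorm_on ::
  "'a::real_normed_vector set \<Rightarrow> ('a \<Rightarrow> 'b::real_normed_vector) \<Rightarrow> real" where
  "onorm_on S f = (SUP u\<in>S. norm (f u) / norm u)"

text \<open>
  Hilbert space adjoint of \<open>f\<close> as an operator from \<open>S\<close>. For a bounded linear \<open>f\<close> on a complete
  subspace \<open>S\<close> the described vector exists and is unique, by the Riesz representation theorem.
\<close>

definition adjoint_on ::
  "'a::real_inner set \<Rightarrow> ('a \<Rightarrow> 'b::real_inner) \<Rightarrow> 'b \<Rightarrow> 'a" where
  "adjoint_on S f z = (THE v. v \<in> S \<and> (\<forall>u\<in>S. inner (f u) z = inner u v))"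

text \<open>
  The inner product of the type \<open>'a ^ 'n\<close> is the sum of the inner products of the components, so
  that \<open>block_prod X\<close> carries the natural product inner product.
\<close>

definition block_prod :: "('n::finite \<Rightarrow> 'a set) \<Rightarrow> ('a ^ 'n) set" where
  "block_prod X = {x. \<forall>i. x $ i \<in> X i}"

definition block_op ::
  "('n::finite \<Rightarrow> 'a \<Rightarrow> 'b::real_inner) \<Rightarrow> 'a ^ 'n \<Rightarrow> 'b" where
  "block_op A x = (\<Sum>i\<in>UNIV. A i (x $ i))"

text \<open>
  \<open>rbcd X A \<gamma> z x0 \<iota> k\<close> is the \<open>k\<close>-th iterate for the data \<open>z\<close> along the index sequence \<open>\<iota>\<close>.
\<close>

primrec rbcd ::
  "('n::finite \<Rightarrow> 'a::real_inner set) \<Rightarrow> ('n \<Rightarrow> 'a \<Rightarrow> 'b::real_inner) \<Rightarrow> real \<Rightarrow> 'b \<Rightarrow>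
   'a ^ 'n \<Rightarrow> (nat \<Rightarrow> 'n) \<Rightarrow> nat \<Rightarrow> 'a ^ 'n" where
  "rbcd X A \<gamma> z x0 \<iota> 0 = x0"
| "rbcd X A \<gamma> z x0 \<iota> (Suc k) =
     (let x = rbcd X A \<gamma> z x0 \<iota> k in
        \<chi> i. if i = \<iota> k
             then x $ i - \<gamma> *\<^sub>R adjoint_on (X i) (A i) (block_op A x - z)
             else x $ i)"

end

theory Submission
  imports Defs
begin

text \<open>
  Write \<open>w = y\<delta> - y\<close>, let \<open>e\<close> be the difference of the two iterates and \<open>r = A e - w\<close>. A step in
  block \<open>i\<close> replaces \<open>e\<^sub>i\<close> by \<open>e\<^sub>i - \<gamma> A\<^sub>i\<^sup>* r\<close>, hence \<open>r\<close> by \<open>r - \<gamma> A\<^sub>i A\<^sub>i\<^sup>* r\<close>, which is not longer because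
  \<open>\<gamma> \<parallel>A\<^sub>i\<parallel>\<^sup>2 \<le> 2\<close>. Averaging \<open>\<parallel>e\<parallel>\<^sup>2\<close> after the step over \<open>i\<close> gives
  \<open>\<parallel>e\<parallel>\<^sup>2 - (2 \<gamma> / b) (\<parallel>r\<parallel>\<^sup>2 + (w, r)) + (\<gamma>\<^sup>2 / b) \<parallel>A\<^sup>* r\<parallel>\<^sup>2\<close>, where \<open>\<gamma> \<parallel>A\<^sup>* r\<parallel>\<^sup>2 \<le> 2 \<parallel>r\<parallel>\<^sup>2\<close> cancels the first
  bracketed term and \<open>- (w, r) \<le> \<delta>\<^sup>2\<close> by the residual bound.
\<close>

section \<open>Bounded linear maps on a subspace\<close>

lemma is_bounded_linear_on_add:
  "is_bounded_linear_on S f \<Longrightarrow> u \<in> S \<Longrightarrow> v \<in> S \<Longrightarrow> f (u + v) = f u + f v"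
  by (simp add: is_bounded_linear_on_def)

lemma is_bounded_linear_on_scaleR:
  "is_bounded_linear_on S f \<Longrightarrow> u \<in> S \<Longrightarrow> f (c *\<^sub>R u) = c *\<^sub>R f u"
  by (simp add: is_bounded_linear_on_def)

lemma is_bounded_linear_on_diff:
  assumes "is_bounded_linear_on S f" "subspace S" "u \<in> S" "v \<in> S"
  shows "f (u - v) = f u - f v"
  using is_bounded_linear_on_add[OF assms(1), of u "(-1) *\<^sub>R v"]
    is_bounded_linear_on_scaleR[OF assms(1), of v "-1"] subspace_scale[of S v "-1"] assms
  by simp

lemma is_bounded_linear_on_bound:
  assumes "is_bounded_linear_on S f"
  obtains K where "K \<ge> 0" "\<And>u. u \<in> S \<Longrightarrow> norm (f u) \<le> K * norm u"
proof -
  obtain K where K: "\<forall>u\<in>S. norm (f u) \<le> norm u * K"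
    using assms by (auto simp: is_bounded_linear_on_def)
  have "norm (f u) \<le> \<bar>K\<bar> * norm u" if "u \<in> S" for u
    using K that mult_left_mono[of K "\<bar>K\<bar>" "norm u"] by (force simp: mult.commute)
  then show ?thesis using that[of "\<bar>K\<bar>"] by simp
qed

lemma is_bounded_linear_on_inner:
  assumes "is_bounded_linear_on S f"
  shows "is_bounded_linear_on S (\<lambda>u. inner (f u) z)"
proof -
  obtain K where K: "K \<ge> 0" "\<And>u. u \<in> S \<Longrightarrow> norm (f u) \<le> K * norm u"
    using is_bounded_linear_on_bound[OF assms] by blast
  have "norm (inner (f u) z) \<le> norm u * (K * norm z)" if "u \<in> S" for u
  proof -
    have "norm (inner (f u) z) \<le> norm (f u) * norm z"
      by (simp add: Cauchy_Schwarz_ineq2)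
    also have "\<dots> \<le> (K * norm u) * norm z"
      using K that by (intro mult_right_mono) auto
    finally show ?thesis by (simp add: mult_ac)
  qed
  then show ?thesis
    using assms by (auto simp: is_bounded_linear_on_def inner_add_left)
qed

section \<open>Riesz representation and adjoints on complete subspaces\<close>

text \<open>First-order condition at a minimum: for small \<open>t\<close> of sign opposite to
  \<open>a\<close>, the linear term outweighs the quadratic one.\<close>

lemma linear_le_square_imp_zero:
  fixes a q :: real
  assumes "\<And>t. 0 \<le> t * a + t\<^sup>2 * q"
  shows "a = 0"
proof (rule ccontr)
  assume "a \<noteq> 0"
  \<comment> \<open>Taking \<open>p\<close> positive and strictly above \<open>q\<close> makes
    \<open>t = - a / p\<close> a point where the quadratic is negative, whatever the sign of
    \<open>q\<close>.\<close>
  define p where "p = \<bar>q\<bar> + 1"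
  have p: "p > 0" "q < p" by (auto simp: p_def)
  have "0 \<le> (- a / p) * a + (- a / p)\<^sup>2 * q" by (rule assms)
  also have "\<dots> = (a\<^sup>2 / p\<^sup>2) * (q - p)"
  proof -
    have "(- a / p) * a = - (a\<^sup>2 / p\<^sup>2) * p"
      using p by (simp add: power2_eq_square)
    then show ?thesis by (simp add: power_divide right_diff_distrib)
  qed
  also have "\<dots> < 0"
    using p \<open>a \<noteq> 0\<close> by (intro mult_pos_neg) auto
  finally show False by simp
qed

text \<open>The representing vector is the minimiser of \<open>\<parallel>u\<parallel>\<^sup>2 - 2 \<phi> u\<close> over the subspace.\<close>

lemma riesz_representation_on:
  fixes S :: "'a::real_inner set" and \<phi> :: "'a \<Rightarrow> real"
  assumes S: "subspace S" "Topological_Spaces.complete S" and \<phi>: "is_bounded_linear_on S \<phi>"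
  shows "\<exists>v\<in>S. \<forall>u\<in>S. \<phi> u = inner u v"
proof -
  obtain K where K: "K \<ge> 0" "\<And>u. u \<in> S \<Longrightarrow> \<bar>\<phi> u\<bar> \<le> K * norm u"
    using is_bounded_linear_on_bound[OF \<phi>] by (metis real_norm_def)
  define J where "J u = (norm u)\<^sup>2 - 2 * \<phi> u" for u
  define m where "m = Inf (J ` S)"
  \<comment> \<open>Completing the square in \<open>norm u - K\<close>.\<close>
  have "J u \<ge> - K\<^sup>2" if "u \<in> S" for u
    using K(2)[OF that] zero_le_power2[of "norm u - K"]
    by (simp add: J_def power2_eq_square algebra_simps)
  then have bdd: "bdd_below (J ` S)" by (auto intro!: bdd_belowI)
  have m: "m \<le> J u" if "u \<in> S" for u
    unfolding m_def using bdd that by (simp add: cINF_lower)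
  have "\<exists>u\<in>S. J u < m + 1 / real (Suc n)" for n
  proof -
    have "Inf (J ` S) < m + 1 / real (Suc n)" by (simp add: m_def)
    moreover have "S \<noteq> {}" using subspace_0[OF S(1)] by auto
    ultimately show ?thesis by (subst (asm) cInf_less_iff) (use bdd in auto)
  qed
  then obtain f where f: "\<And>n. f n \<in> S" "\<And>n. J (f n) < m + 1 / real (Suc n)"
    by metis
  \<comment> \<open>The midpoint of \<open>u\<close> and \<open>v\<close> lies in \<open>S\<close>,
    so \<open>J\<close> is at least \<open>m\<close> there; the parallelogram law then shows that
    near-minimisers are close to each other.\<close>
  have parallelogram: "(norm (u - v))\<^sup>2 \<le> 2 * (J u - m) + 2 * (J v - m)" if "u \<in> S" "v \<in> S" for u v
  proof -
    have uv: "u + v \<in> S" using that S by (simp add: subspace_add)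
    have "J ((1/2) *\<^sub>R (u + v)) = (norm (u + v))\<^sup>2 / 4 - (\<phi> u + \<phi> v)"
      unfolding J_def is_bounded_linear_on_scaleR[OF \<phi> uv] is_bounded_linear_on_add[OF \<phi> that]
        norm_scaleR power_mult_distrib
      by (simp add: power_divide add_divide_distrib)
    then have "4 * m \<le> (norm (u + v))\<^sup>2 - 4 * (\<phi> u + \<phi> v)"
      using m[OF subspace_scale[OF S(1) uv, of "1/2"]] by simp
    then show ?thesis
      by (simp add: J_def power2_norm_eq_inner inner_commute algebra_simps)
  qed
  have "Cauchy f"
  proof (rule metric_CauchyI)
    fix e :: real assume "e > 0"
    \<comment> \<open>Two gaps below \<open>e\<^sup>2 / 4\<close>, each with factor 2 in
      \<open>parallelogram\<close>, add up to less than \<open>e\<^sup>2\<close>.\<close>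
    then obtain N where N: "1 / real (Suc N) < e\<^sup>2 / 4"
      using nat_approx_posE[of "e\<^sup>2 / 4"] by auto
    have "dist (f i) (f j) < e" if "i \<ge> N" "j \<ge> N" for i j
    proof -
      have "J (f k) - m < e\<^sup>2 / 4" if "k \<ge> N" for k
      proof -
        have "1 / real (Suc k) \<le> 1 / real (Suc N)"
          using that by (intro divide_left_mono) auto
        then show ?thesis using f(2)[of k] N by linarith
      qed
      from this[OF that(1)] this[OF that(2)] parallelogram[OF f(1) f(1), of i j]
      have "(norm (f i - f j))\<^sup>2 < e\<^sup>2" by (simp add: field_simps)
      then show ?thesis
        using \<open>e > 0\<close> by (simp add: dist_norm power2_less_imp_less)
    qed
    then show "\<exists>M. \<forall>i\<ge>M. \<forall>j\<ge>M. dist (f i) (f j) < e" by blast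
  qed
  then obtain v where v: "v \<in> S" "f \<longlonglongrightarrow> v"
    using S(2) f(1) unfolding metric_space_class.complete_def by blast
  have "(\<lambda>n. \<phi> (f n) - \<phi> v) \<longlonglongrightarrow> 0"
  proof (rule Lim_null_comparison)
    show "\<forall>\<^sub>F n in sequentially. norm (\<phi> (f n) - \<phi> v) \<le> K * norm (f n - v)"
      using K(2) is_bounded_linear_on_diff[OF \<phi> S(1) f(1) v(1)] subspace_diff[OF S(1) f(1) v(1)]
      by (intro always_eventually) (metis real_norm_def)
    have "(\<lambda>n. norm (f n - v)) \<longlonglongrightarrow> 0" using v(2) LIM_zero tendsto_norm_zero by blast
    then show "(\<lambda>n. K * norm (f n - v)) \<longlonglongrightarrow> 0" by (rule tendsto_mult_right_zero)
  qed
  then have "(\<lambda>n. J (f n)) \<longlonglongrightarrow> J v"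
    unfolding J_def by (intro tendsto_intros v(2)) (rule LIM_zero_cancel)
  moreover have "(\<lambda>n. m + 1 / real (Suc n)) \<longlonglongrightarrow> m + 0"
    by (intro tendsto_intros LIMSEQ_Suc lim_inverse_n' )
  ultimately have Jv: "J v \<le> m"
    using f(2) by (intro LIMSEQ_le[of "\<lambda>n. J (f n)" _ "\<lambda>n. m + 1 / real (Suc n)"])
      (auto intro!: less_imp_le)
  have "\<phi> u = inner u v" if u: "u \<in> S" for u
  proof -
    \<comment> \<open>This is \<open>J (v + t *\<^sub>R u) - J v\<close>, nonnegative because
      \<open>v\<close> is a minimiser.\<close>
    have "0 \<le> t * (2 * (inner u v - \<phi> u)) + t\<^sup>2 * (norm u)\<^sup>2" for t
    proof -
      have tu: "t *\<^sub>R u \<in> S" using u S by (simp add: subspace_scale)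
      have "J v \<le> J (v + t *\<^sub>R u)"
        using Jv m[of "v + t *\<^sub>R u"] tu v S by (simp add: subspace_add)
      then show ?thesis
        using is_bounded_linear_on_add[OF \<phi> v(1) tu] is_bounded_linear_on_scaleR[OF \<phi> u, of t]
        unfolding J_def power2_norm_eq_inner
        by (simp add: power2_eq_square inner_commute algebra_simps)
    qed
    then have "2 * (inner u v - \<phi> u) = 0" by (rule linear_le_square_imp_zero)
    then show ?thesis by simp
  qed
  with v(1) show ?thesis by blast
qed

text \<open>The difference of two candidates lies in \<open>S\<close> and is orthogonal to all of
  \<open>S\<close>, hence to itself. This evaluates the description operator in
  \<open>adjoint_on\<close>.\<close>

lemma adjoint_on_unique:
  assumes "subspace S" "v \<in> S" "\<And>u. u \<in> S \<Longrightarrow> inner (f u) z = inner u v"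
  shows "adjoint_on S f z = v"
  unfolding adjoint_on_def
proof (rule the_equality)
  fix w assume w: "w \<in> S \<and> (\<forall>u\<in>S. inner (f u) z = inner u w)"
  then have "w - v \<in> S" using assms by (simp add: subspace_diff)
  then have "inner (w - v) w = inner (w - v) v" using w assms(3) by metis
  then have "inner (w - v) (w - v) = 0" by (simp add: inner_diff_right)
  then show "w = v" by simp
qed (use assms in auto)

lemma adjoint_on_props:
  assumes "subspace S" "Topological_Spaces.complete S" "is_bounded_linear_on S f"
  shows adjoint_on_mem: "adjoint_on S f z \<in> S"
    and inner_adjoint_on: "u \<in> S \<Longrightarrow> inner (f u) z = inner u (adjoint_on S f z)"
proof -
  obtain v where v: "v \<in> S" "\<And>u. u \<in> S \<Longrightarrow> inner (f u) z = inner u v"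
    using riesz_representation_on[OF assms(1,2) is_bounded_linear_on_inner[OF assms(3)]] by metis
  then have "adjoint_on S f z = v" using adjoint_on_unique assms(1) by blast
  with v show "adjoint_on S f z \<in> S" "u \<in> S \<Longrightarrow> inner (f u) z = inner u (adjoint_on S f z)"
    by auto
qed

lemma adjoint_on_diff:
  assumes "subspace S" "Topological_Spaces.complete S" "is_bounded_linear_on S f"
  shows "adjoint_on S f (z - w) = adjoint_on S f z - adjoint_on S f w"
  using adjoint_on_mem[OF assms] inner_adjoint_on[OF assms] assms(1)
  by (intro adjoint_on_unique) (auto simp: subspace_diff inner_diff_right)

section \<open>Relative operator norm and the block operator\<close>

lemma norm_le_onorm_on:
  assumes "is_bounded_linear_on S f" "u \<in> S"
  shows "norm (f u) \<le> onorm_on S f * norm u"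
proof (cases "u = 0")
  case True
  then show ?thesis using is_bounded_linear_on_scaleR[OF assms, of 0] by simp
next
  case False
  obtain K where K: "K \<ge> 0" "\<And>u. u \<in> S \<Longrightarrow> norm (f u) \<le> K * norm u"
    using is_bounded_linear_on_bound[OF assms(1)] by blast
  have "norm (f v) / norm v \<le> K" if "v \<in> S" for v
    using K that by (cases "v = 0") (auto simp: divide_le_eq)
  \<comment> \<open>A real supremum dominates its members only if the set is bounded above. The
    quotient at the zero vector is 0 and does no harm.\<close>
  then have "bdd_above ((\<lambda>v. norm (f v) / norm v) ` S)" by (auto intro!: bdd_aboveI)
  then have "norm (f u) / norm u \<le> onorm_on S f"
    unfolding onorm_on_def using assms(2) by (rule cSUP_upper2) auto
  then show ?thesis using False by (simp add: divide_le_eq)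
qed

lemma subspace_block_prod: "(\<And>i. subspace (X i)) \<Longrightarrow> subspace (block_prod X)"
  by (auto simp: subspace_def block_prod_def)

lemma axis_in_block_prod:
  assumes "\<And>i. subspace (X i)" "v \<in> X i"
  shows "axis i v \<in> block_prod X"
  using assms by (auto simp: block_prod_def axis_def subspace_0)

lemma norm_axis: "norm (axis i v) = norm (v :: 'a::real_inner)"
  by (simp add: norm_eq_sqrt_inner inner_axis_axis)

lemma is_bounded_linear_on_block_op:
  fixes X :: "'n::finite \<Rightarrow> 'a::real_inner set"
  assumes "\<And>i. is_bounded_linear_on (X i) (A i)"
  shows "is_bounded_linear_on (block_prod X) (block_op A)"
proof -
  have "\<exists>K. K \<ge> 0 \<and> (\<forall>u\<in>X i. norm (A i u) \<le> K * norm u)" for i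
    by (rule is_bounded_linear_on_bound[OF assms[of i]]) blast
  then obtain K where K: "\<And>i. K i \<ge> 0" "\<And>i u. u \<in> X i \<Longrightarrow> norm (A i u) \<le> K i * norm u"
    by metis
  have "norm (block_op A u) \<le> norm u * (\<Sum>i\<in>UNIV. K i)" if "u \<in> block_prod X" for u
  proof -
    have "norm (block_op A u) \<le> (\<Sum>i\<in>UNIV. norm (A i (u $ i)))"
      unfolding block_op_def by (rule norm_sum)
    also have "\<dots> \<le> (\<Sum>i\<in>UNIV. K i * norm (u $ i))"
      using that K(2) by (intro sum_mono) (auto simp: block_prod_def)
    also have "\<dots> \<le> (\<Sum>i\<in>UNIV. K i * norm u)"
      using K(1) by (intro sum_mono mult_left_mono Finite_Cartesian_Product.norm_nth_le)
    finally show ?thesis by (simp add: sum_distrib_left mult.commute)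
  qed
  then show ?thesis
    using assms unfolding is_bounded_linear_on_def block_op_def
    by (auto simp: block_prod_def sum.distrib scaleR_sum_right)
qed

text \<open>Together with \<open>norm_axis\<close>, this passes a bound on the whole operator to
  each block. The other blocks contribute \<open>A j 0\<close>, which vanishes by homogeneity since
  \<open>0\<close> lies in \<open>X j\<close>.\<close>

lemma block_op_axis:
  assumes "\<And>i. subspace (X i)" "\<And>i. is_bounded_linear_on (X i) (A i)"
  shows "block_op A (axis i v) = A i v"
proof -
  have "A j 0 = 0" for j
    using is_bounded_linear_on_scaleR[OF assms(2) subspace_0[OF assms(1)], of j 0] by simp
  then have "block_op A (axis i v) = (\<Sum>j\<in>UNIV. if j = i then A i v else 0)"
    unfolding block_op_def by (intro sum.cong) (auto simp: axis_def)
  then show ?thesis by simp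
qed

section \<open>Averaging over the newest random index\<close>

text \<open>Replaces conditioning on the past: by the third hypothesis \<open>F\<close> sees only
  the indices before \<open>k\<close>, so it is independent of \<open>I k\<close>, and splitting by
  the value of \<open>I k\<close> turns the random choice into an average.\<close>

lemma (in prob_space) expectation_uniform_last:
  fixes I :: "nat \<Rightarrow> 'a \<Rightarrow> 'n::finite" and F :: "(nat \<Rightarrow> 'n) \<Rightarrow> 'n \<Rightarrow> real"
  assumes indep: "indep_vars (\<lambda>_. count_space UNIV) I UNIV"
    and unif: "distr M (count_space UNIV) (I k) = uniform_count_measure UNIV"
    and F: "\<And>\<iota> \<kappa> i. (\<And>j. j < k \<Longrightarrow> \<iota> j = \<kappa> j) \<Longrightarrow> F \<iota> i = F \<kappa> i"
  shows integrable_uniform_last: "integrable M (\<lambda>\<omega>. F (\<lambda>j. I j \<omega>) i)"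
    and "integrable M (\<lambda>\<omega>. F (\<lambda>j. I j \<omega>) (I k \<omega>))"
    and "expectation (\<lambda>\<omega>. F (\<lambda>j. I j \<omega>) (I k \<omega>)) =
           expectation (\<lambda>\<omega>. (\<Sum>i\<in>UNIV. F (\<lambda>j. I j \<omega>) i) / real CARD('n))"
proof -
  let ?I = "\<lambda>\<omega>. restrict (\<lambda>j. I j \<omega>) {..<k}"
  have rv: "I j \<in> measurable M (count_space UNIV)" for j
    using indep by (simp add: indep_vars_def2)
  \<comment> \<open>The space of prefixes is discrete, so every function of a prefix is
    measurable.\<close>
  have PiM: "(\<Pi>\<^sub>M j\<in>{..<k}. count_space (UNIV :: 'n set)) = count_space ({..<k} \<rightarrow>\<^sub>E UNIV)"
    by (rule count_space_PiM_finite) auto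
  have "?I \<in> measurable M (\<Pi>\<^sub>M j\<in>{..<k}. count_space UNIV)"
    using rv by (intro measurable_restrict) auto
  then have I_meas: "?I \<in> measurable M (count_space ({..<k} \<rightarrow>\<^sub>E UNIV))" by (simp add: PiM)
  have F_restrict: "F (\<lambda>j. I j \<omega>) i = F (?I \<omega>) i" for \<omega> i by (rule F) auto
  have F_meas: "(\<lambda>\<omega>. F (\<lambda>j. I j \<omega>) i) \<in> borel_measurable M" for i
    unfolding F_restrict by (rule measurable_compose[OF I_meas]) auto
  show int: "integrable M (\<lambda>\<omega>. F (\<lambda>j. I j \<omega>) i)" for i
  proof (rule integrable_const_bound)
    have "finite (({..<k} \<rightarrow>\<^sub>E UNIV) :: (nat \<Rightarrow> 'n) set)" by (auto intro: finite_PiE)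
    \<comment> \<open>There are only finitely many prefixes, so the sum over all of them is a
      constant bound.\<close>
    then show "AE \<omega> in M. norm (F (\<lambda>j. I j \<omega>) i) \<le>
        (\<Sum>\<iota>\<in>({..<k} \<rightarrow>\<^sub>E UNIV). norm (F \<iota> i))"
      unfolding F_restrict by (intro AE_I2 member_le_sum) (auto simp: PiE_iff extensional_def)
  qed (rule F_meas)
  have indep_last: "indep_var borel (\<lambda>\<omega>. F (\<lambda>j. I j \<omega>) i) borel (\<lambda>\<omega>. indicator {i} (I k \<omega>) :: real)" for i
  proof -
    have "indep_var (\<Pi>\<^sub>M j\<in>{..<k}. count_space UNIV) ?I
        (\<Pi>\<^sub>M j\<in>{k}. count_space UNIV) (\<lambda>\<omega>. restrict (\<lambda>j. I j \<omega>) {k})"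
      by (rule indep_var_restrict[OF indep]) auto
    from indep_var_compose[OF this, of "\<lambda>\<iota>. F \<iota> i" borel "\<lambda>\<iota>. indicator {i} (\<iota> k)" borel]
    show ?thesis by (simp add: PiM F_restrict[symmetric] comp_def)
  qed
  have ind_int: "integrable M (\<lambda>\<omega>. indicator {i} (I k \<omega>) :: real)" for i
    by (rule integrable_const_bound[of _ 1]) (use rv in \<open>auto simp: indicator_def\<close>)
  have ind_exp: "expectation (\<lambda>\<omega>. indicator {i} (I k \<omega>)) = 1 / real CARD('n)" for i
  proof -
    have "expectation (\<lambda>\<omega>. indicator {i} (I k \<omega>)) =
        (\<integral>x. indicator {i} x \<partial>distr M (count_space UNIV) (I k) :: real)"
      by (rule integral_distr[symmetric]) (use rv in auto)
    also have "\<dots> = 1 / real CARD('n)"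
      unfolding unif by (simp add: measure_uniform_count_measure)
    finally show ?thesis .
  qed
  have split: "F \<iota> l = (\<Sum>i\<in>UNIV. F \<iota> i * indicator {i} l)" for \<iota> l
    by (simp add: indicator_def)
  have prod_int: "integrable M (\<lambda>\<omega>. F (\<lambda>j. I j \<omega>) i * indicator {i} (I k \<omega>))" for i
    by (rule indep_var_integrable[OF indep_last int ind_int])
  show "integrable M (\<lambda>\<omega>. F (\<lambda>j. I j \<omega>) (I k \<omega>))"
    by (subst split) (intro Bochner_Integration.integrable_sum prod_int)
  have "expectation (\<lambda>\<omega>. F (\<lambda>j. I j \<omega>) (I k \<omega>)) =
      (\<Sum>i\<in>UNIV. expectation (\<lambda>\<omega>. F (\<lambda>j. I j \<omega>) i * indicator {i} (I k \<omega>)))"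
    by (subst split) (intro Bochner_Integration.integral_sum prod_int)
  also have "\<dots> = (\<Sum>i\<in>UNIV. expectation (\<lambda>\<omega>. F (\<lambda>j. I j \<omega>) i) / real CARD('n))"
    by (simp add: indep_var_lebesgue_integral[OF indep_last int ind_int] ind_exp)
  also have "\<dots> = expectation (\<lambda>\<omega>. (\<Sum>i\<in>UNIV. F (\<lambda>j. I j \<omega>) i) / real CARD('n))"
    using int by (simp add: sum_divide_distrib[symmetric] Bochner_Integration.integral_sum)
  finally show "expectation (\<lambda>\<omega>. F (\<lambda>j. I j \<omega>) (I k \<omega>)) =
      expectation (\<lambda>\<omega>. (\<Sum>i\<in>UNIV. F (\<lambda>j. I j \<omega>) i) / real CARD('n))" .
qed

section \<open>The iterates, the step size condition and one-step estimates\<close>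

text \<open>Iterate \<open>k\<close> depends on the indices before \<open>k\<close> only, since
  index \<open>k\<close> first acts in passing to \<open>Suc k\<close>. This is what
  \<open>expectation_uniform_last\<close> asks of its integrand.\<close>

lemma rbcd_cong:
  "(\<And>j. j < k \<Longrightarrow> \<iota> j = \<kappa> j) \<Longrightarrow> rbcd X A \<gamma> z x0 \<iota> k = rbcd X A \<gamma> z x0 \<kappa> k"
  by (induction k) simp_all

lemma rbcd_Suc_axis:
  "rbcd X A \<gamma> z x0 \<iota> (Suc k) = rbcd X A \<gamma> z x0 \<iota> k -
     axis (\<iota> k) (\<gamma> *\<^sub>R adjoint_on (X (\<iota> k)) (A (\<iota> k)) (block_op A (rbcd X A \<gamma> z x0 \<iota> k) - z))"
  by (auto simp: Let_def vec_eq_iff axis_def)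

text \<open>The upper bound on \<open>\<gamma>\<close> is conditional because division by zero
  yields 0: for a vanishing operator it would read \<open>\<gamma> \<le> 0\<close>, whereas every
  positive step is then admissible.\<close>

locale bounded_blocks =
  fixes X :: "'n::finite \<Rightarrow> 'a::real_inner set"
    and A :: "'n \<Rightarrow> 'a \<Rightarrow> 'b::real_inner"
    and \<gamma> :: real
  assumes subspace: "\<And>i. subspace (X i)"
    and complete: "\<And>i. Topological_Spaces.complete (X i)"
    and bounded_linear: "\<And>i. is_bounded_linear_on (X i) (A i)"
    and step_pos: "\<gamma> > 0"
    and step_le: "onorm_on (block_prod X) (block_op A) \<noteq> 0 \<Longrightarrow>
           \<gamma> \<le> 2 / (onorm_on (block_prod X) (block_op A))\<^sup>2"
begin

abbreviation "adj i \<equiv> adjoint_on (X i) (A i)"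

lemmas subspace_prod = subspace_block_prod[of X, OF subspace]
lemmas block_op_linear = is_bounded_linear_on_block_op[of X A, OF bounded_linear]
lemmas adj_mem = adjoint_on_mem[OF subspace complete bounded_linear]
lemmas inner_adj = inner_adjoint_on[OF subspace complete bounded_linear]
lemmas adj_diff = adjoint_on_diff[OF subspace complete bounded_linear]
lemmas op_axis = block_op_axis[of X A, OF subspace bounded_linear]

lemma scaled_axis_mem: "v \<in> X i \<Longrightarrow> axis i (c *\<^sub>R v) \<in> block_prod X"
  by (rule axis_in_block_prod) (simp_all add: subspace subspace_scale)

text \<open>The step size condition freed of division, covering a vanishing operator norm as well;
  all later estimates use it in this form.\<close>

lemma step_norm_block_op:
  assumes "u \<in> block_prod X"
  shows "\<gamma> * (norm (block_op A u))\<^sup>2 \<le> 2 * (norm u)\<^sup>2"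
proof -
  define L where "L = onorm_on (block_prod X) (block_op A)"
  have "\<gamma> * L\<^sup>2 \<le> 2"
    using step_le by (cases "L = 0") (auto simp: L_def le_divide_eq)
  moreover have "(norm (block_op A u))\<^sup>2 \<le> (L * norm u)\<^sup>2"
    unfolding L_def by (intro power_mono norm_le_onorm_on block_op_linear assms) simp
  then have "\<gamma> * (norm (block_op A u))\<^sup>2 \<le> (\<gamma> * L\<^sup>2) * (norm u)\<^sup>2"
    using step_pos by (simp add: power_mult_distrib mult.assoc)
  ultimately show ?thesis
    by (meson mult_right_mono order_trans zero_le_power2)
qed

lemma inner_block_op:
  assumes "u \<in> block_prod X"
  shows "inner (block_op A u) r = inner u (\<chi> i. adj i r)"
  using assms inner_adj by (simp add: block_op_def block_prod_def inner_vec_def inner_sum_left)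

text \<open>The adjoint inherits the bound: for \<open>a\<close> the vector of all
  \<open>adj i r\<close>, the squared norm of \<open>a\<close> equals
  \<open>inner (block_op A a) r\<close>, and \<open>step_norm_block_op\<close> controls
  \<open>block_op A a\<close>.\<close>

lemma step_norm_adj: "\<gamma> * (\<Sum>i\<in>UNIV. (norm (adj i r))\<^sup>2) \<le> 2 * (norm r)\<^sup>2"
proof -
  define a where "a = (\<chi> i. adj i r)"
  have a: "a \<in> block_prod X" using adj_mem by (simp add: a_def block_prod_def)
  have sum: "(\<Sum>i\<in>UNIV. (norm (adj i r))\<^sup>2) = (norm a)\<^sup>2"
    by (simp add: a_def power2_norm_eq_inner inner_vec_def)
  have "(norm a)\<^sup>2 = inner (block_op A a) r"
    using inner_block_op[OF a] by (simp add: a_def power2_norm_eq_inner)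
  \<comment> \<open>AM-GM: \<open>2 (A a, r) \<le> (\<gamma> / 2) \<parallel>A a\<parallel>\<^sup>2 + (2 / \<gamma>) \<parallel>r\<parallel>\<^sup>2\<close>\<close>
  moreover have "0 \<le> (norm ((\<gamma> / 2) *\<^sub>R block_op A a - r))\<^sup>2" by simp
  then have "\<gamma> * inner (block_op A a) r \<le> \<gamma>\<^sup>2 / 4 * (norm (block_op A a))\<^sup>2 + (norm r)\<^sup>2"
    unfolding power2_norm_eq_inner
    by (simp add: inner_diff_left inner_diff_right inner_commute power2_eq_square)
  moreover have "\<gamma> / 4 * (\<gamma> * (norm (block_op A a))\<^sup>2) \<le> \<gamma> / 4 * (2 * (norm a)\<^sup>2)"
    using step_pos by (intro mult_left_mono step_norm_block_op a) simp
  \<comment> \<open>Half of the left side reappears on the right and is absorbed.\<close>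
  ultimately have "\<gamma> * (norm a)\<^sup>2 \<le> \<gamma> * (norm a)\<^sup>2 / 2 + (norm r)\<^sup>2"
    by (simp add: power2_eq_square mult_ac)
  then show ?thesis by (simp add: sum)
qed

lemma residual_step_le:
  fixes e :: "'a ^ 'n" and w :: 'b
  assumes "e \<in> block_prod X"
  defines "r \<equiv> block_op A e - w"
  shows "norm (block_op A (e - axis i (\<gamma> *\<^sub>R adj i r)) - w) \<le> norm r"
proof -
  define v where "v = adj i r"
  have v: "v \<in> X i" by (simp add: v_def adj_mem)
  have "block_op A (e - axis i (\<gamma> *\<^sub>R v)) = block_op A e - \<gamma> *\<^sub>R A i v"
    using is_bounded_linear_on_diff[OF block_op_linear subspace_prod assms(1) scaled_axis_mem[OF v]]
      op_axis is_bounded_linear_on_scaleR[OF bounded_linear v] by simp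
  then have eq: "block_op A (e - axis i (\<gamma> *\<^sub>R v)) - w = r - \<gamma> *\<^sub>R A i v" by (simp add: r_def)
  have "inner (A i v) r = (norm v)\<^sup>2"
    using inner_adj[OF v] by (simp add: v_def power2_norm_eq_inner)
  then have "(norm (r - \<gamma> *\<^sub>R A i v))\<^sup>2 =
      (norm r)\<^sup>2 + \<gamma> * (\<gamma> * (norm (A i v))\<^sup>2 - 2 * (norm v)\<^sup>2)"
    by (simp add: power2_norm_eq_inner inner_diff_left inner_diff_right inner_commute algebra_simps)
  \<comment> \<open>The bound for the whole operator, tested on a vector supported in block
    \<open>i\<close>.\<close>
  moreover have "\<gamma> * (norm (A i v))\<^sup>2 \<le> 2 * (norm v)\<^sup>2"
    using step_norm_block_op[OF axis_in_block_prod[of X, OF subspace v]] op_axis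
    by (simp add: norm_axis)
  ultimately have "(norm (r - \<gamma> *\<^sub>R A i v))\<^sup>2 \<le> (norm r)\<^sup>2"
    using step_pos by (simp add: mult_le_0_iff)
  then show ?thesis unfolding v_def[symmetric] eq by simp
qed

lemma average_step_le:
  fixes e :: "'a ^ 'n" and w :: 'b
  assumes "e \<in> block_prod X" and r_le: "norm (block_op A e - w) \<le> \<delta>" and w_le: "norm w \<le> \<delta>"
  defines "r \<equiv> block_op A e - w"
  shows "(\<Sum>i\<in>UNIV. (norm (e - axis i (\<gamma> *\<^sub>R adj i r)))\<^sup>2) / real CARD('n)
           \<le> (norm e)\<^sup>2 + 2 * \<gamma> / real CARD('n) * \<delta>\<^sup>2"
proof -
  let ?b = "real CARD('n)"
  \<comment> \<open>The cross term only sees component \<open>i\<close>, and the adjoint turns it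
    into \<open>inner (A i (e $ i)) r\<close>; these add up over \<open>i\<close> to
    \<open>inner (block_op A e) r\<close>.\<close>
  have "(norm (e - axis i (\<gamma> *\<^sub>R adj i r)))\<^sup>2 =
      (norm e)\<^sup>2 - 2 * \<gamma> * inner (A i (e $ i)) r + \<gamma>\<^sup>2 * (norm (adj i r))\<^sup>2" for i
    using assms(1) inner_adj[of "e $ i" i r]
    unfolding power2_norm_eq_inner
    by (simp add: block_prod_def inner_diff_left inner_diff_right
        inner_axis inner_axis' inner_axis_axis inner_commute power2_eq_square)
  then have "(\<Sum>i\<in>UNIV. (norm (e - axis i (\<gamma> *\<^sub>R adj i r)))\<^sup>2) =
      ?b * (norm e)\<^sup>2 - 2 * \<gamma> * inner (block_op A e) r + \<gamma>\<^sup>2 * (\<Sum>i\<in>UNIV. (norm (adj i r))\<^sup>2)"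
    by (simp add: sum.distrib sum_subtractf sum_distrib_left block_op_def inner_sum_left)
  also have "inner (block_op A e) r = (norm r)\<^sup>2 + inner w r"
    by (simp add: r_def power2_norm_eq_inner inner_diff_left)
  finally have sum: "(\<Sum>i\<in>UNIV. (norm (e - axis i (\<gamma> *\<^sub>R adj i r)))\<^sup>2) =
      ?b * (norm e)\<^sup>2 - 2 * \<gamma> * inner w r +
      \<gamma> * (\<gamma> * (\<Sum>i\<in>UNIV. (norm (adj i r))\<^sup>2) - 2 * (norm r)\<^sup>2)"
    by (simp add: algebra_simps power2_eq_square)
  have "\<bar>inner w r\<bar> \<le> norm w * norm r" by (rule Cauchy_Schwarz_ineq2)
  also have "\<dots> \<le> \<delta> * \<delta>"
    using r_le w_le by (intro mult_mono) (auto simp: r_def intro: order_trans[OF norm_ge_zero])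
  finally have "- inner w r \<le> \<delta>\<^sup>2" by (simp add: power2_eq_square)
  then have "2 * \<gamma> * (- inner w r) \<le> 2 * \<gamma> * \<delta>\<^sup>2"
    using step_pos by (intro mult_left_mono) auto
  moreover have "\<gamma> * (\<gamma> * (\<Sum>i\<in>UNIV. (norm (adj i r))\<^sup>2) - 2 * (norm r)\<^sup>2) \<le> 0"
    using step_norm_adj[of r] step_pos by (simp add: mult_le_0_iff)
  ultimately have "(\<Sum>i\<in>UNIV. (norm (e - axis i (\<gamma> *\<^sub>R adj i r)))\<^sup>2) \<le>
      ?b * (norm e)\<^sup>2 + 2 * \<gamma> * \<delta>\<^sup>2"
    unfolding sum by simp
  then have "(\<Sum>i\<in>UNIV. (norm (e - axis i (\<gamma> *\<^sub>R adj i r)))\<^sup>2) / ?b \<le>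
      (?b * (norm e)\<^sup>2 + 2 * \<gamma> * \<delta>\<^sup>2) / ?b"
    by (rule divide_right_mono) simp
  then show ?thesis by (simp add: add_divide_distrib)
qed

section \<open>The error recursion along a sample path\<close>

lemma rbcd_mem: "x0 \<in> block_prod X \<Longrightarrow> rbcd X A \<gamma> z x0 \<iota> k \<in> block_prod X"
  by (induction k)
    (auto simp del: rbcd.simps(2) simp: rbcd_Suc_axis intro!: subspace_diff[OF subspace_prod] scaled_axis_mem adj_mem)

abbreviation "err z y x0 \<iota> k \<equiv> rbcd X A \<gamma> z x0 \<iota> k - rbcd X A \<gamma> y x0 \<iota> k"

lemma err_mem: "x0 \<in> block_prod X \<Longrightarrow> err z y x0 \<iota> k \<in> block_prod X"
  by (intro subspace_diff[OF subspace_prod] rbcd_mem)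

text \<open>Both runs update the same block by an affine map with the same linear part, so their
  difference is again such an iteration, with data \<open>z - y\<close>.\<close>

lemma err_Suc:
  assumes "x0 \<in> block_prod X"
  shows "err z y x0 \<iota> (Suc k) = err z y x0 \<iota> k -
           axis (\<iota> k) (\<gamma> *\<^sub>R adj (\<iota> k) (block_op A (err z y x0 \<iota> k) - (z - y)))"
proof -
  let ?xz = "rbcd X A \<gamma> z x0 \<iota> k" and ?xy = "rbcd X A \<gamma> y x0 \<iota> k"
  have "block_op A (err z y x0 \<iota> k) - (z - y) = (block_op A ?xz - z) - (block_op A ?xy - y)"
    using is_bounded_linear_on_diff[OF block_op_linear subspace_prod rbcd_mem rbcd_mem] assms by simp
  then have "adj (\<iota> k) (block_op A (err z y x0 \<iota> k) - (z - y)) =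
      adj (\<iota> k) (block_op A ?xz - z) - adj (\<iota> k) (block_op A ?xy - y)"
    by (simp only: adj_diff)
  then show ?thesis
    unfolding rbcd_Suc_axis by (simp add: vec_eq_iff axis_def scaleR_diff_right)
qed

lemma residual_err_le:
  assumes "x0 \<in> block_prod X"
  shows "norm (block_op A (err z y x0 \<iota> k) - (z - y)) \<le> norm (z - y)"
proof (induction k)
  case 0
  have "block_op A 0 = 0"
    using is_bounded_linear_on_scaleR[OF block_op_linear assms, of 0] by simp
  \<comment> \<open>Both runs start at \<open>x0\<close>, so the initial error is 0 and the initial
    residual is \<open>- (z - y)\<close>.\<close>
  then show ?case by (simp add: norm_minus_commute)
next
  case (Suc k)
  then show ?case
    using residual_step_le[OF err_mem[OF assms]] unfolding err_Suc[OF assms]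
    by (meson order_trans)
qed

end

section \<open>The pathwise bound and the induction for the mean square error\<close>

theorem lemma2p1:
  fixes X :: "'n::finite \<Rightarrow> 'a::real_inner set"
    and A :: "'n \<Rightarrow> 'a \<Rightarrow> 'b::{real_inner, complete_space}"
    and y y\<delta> :: 'b
    and \<delta> \<gamma> :: real
    and x0 :: "'a ^ 'n"
    and M :: "'w measure"
    and I :: "nat \<Rightarrow> 'w \<Rightarrow> 'n"
  assumes "\<And>i. subspace (X i)"
    and "\<And>i. Topological_Spaces.complete (X i)"
    and "\<And>i. is_bounded_linear_on (X i) (A i)"
    and "y \<in> block_op A ` block_prod X"
    and "\<delta> > 0"
    and "norm (y\<delta> - y) \<le> \<delta>"
    and "x0 \<in> block_prod X"
    and "prob_space M"
    and "prob_space.indep_vars M (\<lambda>_. count_space UNIV) I UNIV"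
    and "\<And>k. distr M (count_space UNIV) (I k) = uniform_count_measure UNIV"
    and "\<gamma> > 0"
    and "onorm_on (block_prod X) (block_op A) \<noteq> 0 \<Longrightarrow>
           \<gamma> \<le> 2 / (onorm_on (block_prod X) (block_op A))\<^sup>2"
  shows "(\<forall>\<omega>\<in>space M. \<forall>k.
            norm (block_op A (rbcd X A \<gamma> y\<delta> x0 (\<lambda>j. I j \<omega>) k - rbcd X A \<gamma> y x0 (\<lambda>j. I j \<omega>) k)
                  - y\<delta> + y) \<le> \<delta>) \<and>
         (\<forall>k.
            integrable M (\<lambda>\<omega>. (norm (rbcd X A \<gamma> y\<delta> x0 (\<lambda>j. I j \<omega>) k
                                      - rbcd X A \<gamma> y x0 (\<lambda>j. I j \<omega>) k))\<^sup>2) \<and>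
            prob_space.expectation M (\<lambda>\<omega>. (norm (rbcd X A \<gamma> y\<delta> x0 (\<lambda>j. I j \<omega>) k
                                      - rbcd X A \<gamma> y x0 (\<lambda>j. I j \<omega>) k))\<^sup>2)
              \<le> 2 * \<gamma> / real CARD('n) * real k * \<delta>\<^sup>2)"
proof (intro conjI allI ballI)
  interpret bounded_blocks X A \<gamma> by unfold_locales (use assms in auto)
  interpret prob_space M by fact
  let ?e = "\<lambda>k \<iota>. err y\<delta> y x0 \<iota> k"
  \<comment> \<open>Stated for an arbitrary index sequence: it gives the pathwise claim and also the
    pointwise hypothesis of \<open>average_step_le\<close>.\<close>
  have residual: "norm (block_op A (?e k \<iota>) - (y\<delta> - y)) \<le> \<delta>" for k \<iota>
    using residual_err_le[OF assms(7)] assms(6) by (rule order_trans)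
  then show "norm (block_op A (?e k (\<lambda>j. I j \<omega>)) - y\<delta> + y) \<le> \<delta>" for k \<omega>
    by (simp add: diff_diff_eq2 diff_add_eq)
  have int: "integrable M (\<lambda>\<omega>. (norm (?e k (\<lambda>j. I j \<omega>)))\<^sup>2)" for k
  \<comment> \<open>The error after \<open>k\<close> steps is a function of the prefix alone, so
    \<open>F\<close> may ignore its second argument.\<close>
  proof (rule integrable_uniform_last[OF assms(9) assms(10)[of k], where F = "\<lambda>\<iota> _. (norm (?e k \<iota>))\<^sup>2"])
    show "(norm (?e k \<iota>))\<^sup>2 = (norm (?e k \<kappa>))\<^sup>2" if "\<And>j. j < k \<Longrightarrow> \<iota> j = \<kappa> j" for \<iota> \<kappa>
      by (simp add: rbcd_cong[of k \<iota> \<kappa>, OF that])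
  qed
  then show "integrable M (\<lambda>\<omega>. (norm (?e k (\<lambda>j. I j \<omega>)))\<^sup>2)" for k .
  show "expectation (\<lambda>\<omega>. (norm (?e k (\<lambda>j. I j \<omega>)))\<^sup>2)
      \<le> 2 * \<gamma> / real CARD('n) * real k * \<delta>\<^sup>2" for k
  proof (induction k)
    case 0
    show ?case by simp
  next
    case (Suc k)
    \<comment> \<open>The squared error after a hypothetical update of block \<open>i\<close>; by
      \<open>err_Suc\<close>, inserting the actual index \<open>I k\<close> gives the squared error
      at \<open>Suc k\<close>.\<close>
    let ?F = "\<lambda>\<iota> i. (norm (?e k \<iota> - axis i (\<gamma> *\<^sub>R adj i (block_op A (?e k \<iota>) - (y\<delta> - y)))))\<^sup>2"
    have F_cong: "?F \<iota> i = ?F \<kappa> i" if "\<And>j. j < k \<Longrightarrow> \<iota> j = \<kappa> j" for \<iota> \<kappa> i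
      by (simp add: rbcd_cong[of k \<iota> \<kappa>, OF that])
    note uniform = expectation_uniform_last[OF assms(9) assms(10)[of k], where F = ?F, OF F_cong]
    have "expectation (\<lambda>\<omega>. (norm (?e (Suc k) (\<lambda>j. I j \<omega>)))\<^sup>2) =
        expectation (\<lambda>\<omega>. (\<Sum>i\<in>UNIV. ?F (\<lambda>j. I j \<omega>) i) / real CARD('n))"
      unfolding err_Suc[OF assms(7)] by (rule uniform(3))
    also have "\<dots> \<le> expectation (\<lambda>\<omega>. (norm (?e k (\<lambda>j. I j \<omega>)))\<^sup>2 + 2 * \<gamma> / real CARD('n) * \<delta>\<^sup>2)"
    proof (rule integral_mono)
      show "integrable M (\<lambda>\<omega>. (\<Sum>i\<in>UNIV. ?F (\<lambda>j. I j \<omega>) i) / real CARD('n))"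
        by (intro Bochner_Integration.integrable_divide Bochner_Integration.integrable_sum uniform(1))
      show "integrable M (\<lambda>\<omega>. (norm (?e k (\<lambda>j. I j \<omega>)))\<^sup>2 + 2 * \<gamma> / real CARD('n) * \<delta>\<^sup>2)"
        by (intro Bochner_Integration.integrable_add int integrable_const)
      show "(\<Sum>i\<in>UNIV. ?F (\<lambda>j. I j \<omega>) i) / real CARD('n)
          \<le> (norm (?e k (\<lambda>j. I j \<omega>)))\<^sup>2 + 2 * \<gamma> / real CARD('n) * \<delta>\<^sup>2" for \<omega>
        by (rule average_step_le[OF err_mem[OF assms(7)] residual assms(6)])
    qed
    also have "\<dots> = expectation (\<lambda>\<omega>. (norm (?e k (\<lambda>j. I j \<omega>)))\<^sup>2) + 2 * \<gamma> / real CARD('n) * \<delta>\<^sup>2"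
      using int by (simp add: prob_space)
    \<comment> \<open>Each step adds the same increment, which yields the factor linear in the
      number of steps.\<close>
    also have "\<dots> \<le> 2 * \<gamma> / real CARD('n) * real (Suc k) * \<delta>\<^sup>2"
      using Suc.IH by (simp add: distrib_left distrib_right add_divide_distrib)
    finally show ?case .
  qed
qed

end
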